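(* For all nonnegative integers $n_1,n_2$, \[ \zeta_2(-n_1,-n_2)+\zeta_2(-n_2,-n_1)+\zeta_1(-n_1-n_2)-\zeta_1(-n_1)\zeta_1(-n_2)=\frac{(-1)^{n_1+1}\,n_1!\,n_2!}{(n_1+n_2+2)!}\,B_{n_1+n_2+2}. \]
   Context: Bernoulli numbers $B_m$ are defined by $\frac{t}{e^t-1}=\sum_{m\ge0}B_m\frac{t^m}{m!}$. The multiple zeta values at negative integers are those of Sadaoui's analytic continuation of the Euler–Zagier multiple zeta function. In the paper's closed form, $\zeta_1(-n)=(-1)^n\frac{B_{n+1}}{n+1}$ and \[ \zeta_2(-n_1,-n_2)=\frac{(-1)^{n_1+n_2}}{n_2+1}\sum_{k=0}^{n_2+1}\binom{n_2+1}{k}\frac{B_{n_1+1+k}}{n_1+1+k}\,B_{n_2+1-k} \] for nonnegative integers $n,n_1,n_2$. *)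

theory Defs
  imports Complex_Main "HOL-Computational_Algebra.Formal_Power_Series"
begin

(* B_m / m! is the m-th coefficient of t / (exp t - 1), so bernoulli 1 = -1/2.
   The division of formal power series is exact: both sides have subdegree 1. *)
definition bernoulli :: "nat \<Rightarrow> real" where
  "bernoulli m = fact m * fps_nth (fps_X / (fps_exp 1 - 1)) m"

lemma bernoulli_generating_function:
  "Abs_fps (\<lambda>m. bernoulli m / fact m) * (fps_exp 1 - 1) = fps_X"
proof -
  let ?E = "fps_exp 1 - 1 :: real fps"
  have nz: "fps_nth ?E 1 \<noteq> 0" "fps_nth ?E 0 = 0"
    by simp_all
  have "?E \<noteq> 0"
    using nz by (metis fps_zero_nth)
  moreover have "subdegree ?E \<le> subdegree (fps_X :: real fps)"
    using nz(1) by (simp add: subdegree_leI)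
  ultimately have "fps_X / ?E * ?E = fps_X"
    by (intro dvd_div_mult_self) (simp add: fps_dvd_iff)
  moreover have "Abs_fps (\<lambda>m. bernoulli m / fact m) = fps_X / ?E"
    by (simp add: fps_eq_iff bernoulli_def)
  ultimately show ?thesis
    by simp
qed

(* Values at non-positive integers of the analytically continued zeta functions, by their
   closed forms; the natural-number arguments stand for the negated arguments:
   zeta1_neg n = zeta_1(-n) and zeta2_neg n1 n2 = zeta_2(-n1,-n2). *)
definition zeta1_neg :: "nat \<Rightarrow> real" where
  "zeta1_neg n = (-1) ^ n * (bernoulli (n + 1) / real (n + 1))"

definition zeta2_neg :: "nat \<Rightarrow> nat \<Rightarrow> real" where
  "zeta2_neg n1 n2 = (-1) ^ (n1 + n2) / real (n2 + 1) *
     (\<Sum>k=0..n2 + 1. real ((n2 + 1) choose k) * (bernoulli (n1 + 1 + k) / real (n1 + 1 + k))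
        * bernoulli (n2 + 1 - k))"

end

theory Submission
  imports Defs
begin

text \<open>
  Put \<open>F(t) = t / (e\<^sup>t - 1) = 1 + t G(t)\<close>. The double zeta values have the exponential generating
  function \<open>(G(x+y) F(y) - G(x)) / y\<close> up to signs. The functional equation
  \<open>(x+y) F(x) F(y) = F(x+y) (x y + y F(x) + x F(y))\<close>, a restatement of
  \<open>e\<^bsup>x+y\<^esup> = e\<^sup>x e\<^sup>y\<close>, shows that the generating function \<open>T\<close> of the left-hand side satisfies
  \<open>(x+y) T = -(1 + G(x) + G(y))\<close>. The coefficients of \<open>T\<close> hence alternate in sign along each
  antidiagonal and are determined by those of \<open>T(x,0)\<close>.

  Bivariate series are elements of \<open>real fps fps\<close>, with \<open>x\<close> the outer and \<open>y\<close> the inner variable.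
\<close>

section \<open>Bivariate series and the substitution x + y\<close>

unbundle fps_syntax

text \<open>This embeds series in x alone; the counterpart for series in y alone is
  \<open>fps_const\<close>.\<close>

definition fps_outer :: "'a::comm_ring_1 fps \<Rightarrow> 'a fps fps" where
  "fps_outer f = Abs_fps (\<lambda>a. fps_const (f $ a))"

text \<open>The substitution \<open>f(x + y)\<close>.\<close>

definition fps_plus_subst :: "'a::comm_ring_1 fps \<Rightarrow> 'a fps fps" where
  "fps_plus_subst f = Abs_fps (\<lambda>a. Abs_fps (\<lambda>b. of_nat ((a + b) choose a) * f $ (a + b)))"

lemma fps_outer_nth [simp]: "fps_outer f $ a = fps_const (f $ a)"
  by (simp add: fps_outer_def)

lemma fps_plus_subst_nth [simp]:
  "fps_plus_subst f $ a $ b = of_nat ((a + b) choose a) * f $ (a + b)"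
  by (simp add: fps_plus_subst_def)

lemma fps_const_sum: "fps_const (\<Sum>i\<in>A. f i) = (\<Sum>i\<in>A. fps_const (f i))"
  by (induction A rule: infinite_finite_induct) (simp_all flip: fps_const_add)

lemma fps_outer_mult: "fps_outer (f * g) = fps_outer f * fps_outer g"
  by (rule fps_ext) (simp add: fps_mult_nth fps_const_sum)

lemma fps_outer_add: "fps_outer (f + g) = fps_outer f + fps_outer g"
  by (rule fps_ext) simp

lemma fps_outer_diff: "fps_outer (f - g) = fps_outer f - fps_outer g"
  by (rule fps_ext) simp

lemma fps_outer_1 [simp]: "fps_outer 1 = 1"
  by (rule fps_ext) simp

lemma fps_outer_X [simp]: "fps_outer fps_X = fps_X"
  by (rule fps_ext) (simp add: fps_X_def)

lemma fps_plus_subst_add: "fps_plus_subst (f + g) = fps_plus_subst f + fps_plus_subst g"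
  by (intro fps_ext) (simp add: algebra_simps)

lemma fps_plus_subst_diff: "fps_plus_subst (f - g) = fps_plus_subst f - fps_plus_subst g"
  by (intro fps_ext) (simp add: algebra_simps)

lemma fps_plus_subst_1 [simp]: "fps_plus_subst 1 = 1"
  by (intro fps_ext) simp

lemma fps_plus_subst_X: "fps_plus_subst fps_X = fps_X + fps_const fps_X"
  by (intro fps_ext) (auto simp: fps_X_def)

lemma fps_plus_subst_deriv: "fps_plus_subst (fps_deriv f) = fps_deriv (fps_plus_subst f)"
proof (intro fps_ext)
  fix a b
  have "of_nat ((a + b) choose a) * of_nat (Suc (a + b))
      = (of_nat (Suc a) * of_nat (Suc (a + b) choose Suc a) :: 'a)"
    by (metis Suc_times_binomial mult.commute of_nat_mult)
  \<comment> \<open>The outer derivative is d/dx, so its factor \<open>Suc a\<close> is a constant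
    series in y.\<close>
  moreover have "(of_nat (Suc a) * g) $ b = of_nat (Suc a) * g $ b" for g :: "'a fps"
    by (simp add: fps_of_nat[symmetric] del: of_nat_Suc)
  ultimately show "fps_plus_subst (fps_deriv f) $ a $ b = fps_deriv (fps_plus_subst f) $ a $ b"
    by (simp add: fps_deriv_nth mult.assoc[symmetric] del: of_nat_Suc binomial_Suc_Suc)
qed

text \<open>Induction on the power of x avoids a binomial convolution. At x^0 both sides are f(y)
  g(y). The next coefficient is read off the x-derivative, where the Leibniz rule leads to the pairs
  f', g and f, g'; hence both series are generalized. Characteristic 0 allows cancelling
  \<open>Suc a\<close>.\<close>

lemma fps_plus_subst_mult:
  fixes f g :: "'a::{idom, ring_char_0} fps"
  shows "fps_plus_subst (f * g) = fps_plus_subst f * fps_plus_subst g"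
proof (rule fps_ext)
  fix a
  show "fps_plus_subst (f * g) $ a = (fps_plus_subst f * fps_plus_subst g) $ a"
  proof (induction a arbitrary: f g)
    case 0
    have "fps_plus_subst h $ 0 = h" for h :: "'a fps"
      by (rule fps_ext) simp
    then show ?case
      by simp
  next
    case (Suc a)
    have "of_nat (Suc a) * fps_plus_subst (f * g) $ Suc a
        = fps_plus_subst (fps_deriv (f * g)) $ a"
      by (simp only: fps_plus_subst_deriv fps_deriv_nth Suc_eq_plus1)
    also have "\<dots> = fps_deriv (fps_plus_subst f * fps_plus_subst g) $ a"
      by (simp add: fps_plus_subst_add Suc.IH fps_plus_subst_deriv)
    also have "\<dots> = of_nat (Suc a) * (fps_plus_subst f * fps_plus_subst g) $ Suc a"
      by (simp only: fps_deriv_nth Suc_eq_plus1)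
    finally have eq: "of_nat (Suc a) * fps_plus_subst (f * g) $ Suc a
        = of_nat (Suc a) * (fps_plus_subst f * fps_plus_subst g) $ Suc a" .
    have "(of_nat (Suc a) :: 'a fps) \<noteq> 0"
      by (metis fps_const_nonzero_eq_nonzero fps_of_nat of_nat_neq_0)
    then show ?case
      using eq by (metis mult_left_cancel)
  qed
qed

lemma fps_plus_subst_exp:
  "fps_plus_subst (fps_exp (1::'a::field_char_0)) = fps_outer (fps_exp 1) * fps_const (fps_exp 1)"
  by (intro fps_ext) (simp add: binomial_fact field_simps)

section \<open>The Bernoulli series and its functional equation\<close>

definition bernoulli_fps :: "real fps" where
  "bernoulli_fps = Abs_fps (\<lambda>m. bernoulli m / fact m)"

text \<open>The series G of the overview; its coefficient at n is (-1)^n \<open>zeta1_neg n\<close>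
  / n!.\<close>

definition bernoulli_tail :: "real fps" where
  "bernoulli_tail = Abs_fps (\<lambda>m. bernoulli (Suc m) / fact (Suc m))"

lemma bernoulli_fps_mult: "bernoulli_fps * (fps_exp 1 - 1) = fps_X"
  using bernoulli_generating_function by (simp add: bernoulli_fps_def)

lemma bernoulli_0: "bernoulli 0 = 1"
proof -
  have "(bernoulli_fps * (fps_exp 1 - 1)) $ 1 = 1"
    by (simp add: bernoulli_fps_mult)
  then show ?thesis
    by (simp add: fps_mult_nth bernoulli_fps_def)
qed

lemma bernoulli_fps_eq: "bernoulli_fps = 1 + fps_X * bernoulli_tail"
  by (rule fps_ext) (auto simp: bernoulli_fps_def bernoulli_tail_def bernoulli_0 gr0_conv_Suc)

text \<open>With u, v, w the series e^t - 1 at t = x, y, x + y, multiplying by u v w clears all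
  denominators and leaves a polynomial identity; u v w then cancels in the integral domain.\<close>

lemma bernoulli_fps_functional_equation:
  defines "f \<equiv> fps_outer bernoulli_fps" and "g \<equiv> fps_const bernoulli_fps"
    and "h \<equiv> fps_plus_subst bernoulli_fps" and "x \<equiv> fps_X" and "y \<equiv> fps_const fps_X"
  shows "(x + y) * f * g = h * (x * y + y * f + x * g)"
proof -
  define u where "u = fps_outer (fps_exp 1 - 1 :: real fps)"
  define v where "v = fps_const (fps_exp 1 - 1 :: real fps)"
  define w where "w = fps_plus_subst (fps_exp 1 - 1 :: real fps)"
  have fu: "f * u = x"
    by (simp add: f_def u_def x_def bernoulli_fps_mult flip: fps_outer_mult)
  have gv: "g * v = y"
    by (simp add: g_def v_def y_def bernoulli_fps_mult)
  have hw: "h * w = x + y"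
    by (simp add: h_def w_def x_def y_def bernoulli_fps_mult fps_plus_subst_X
        flip: fps_plus_subst_mult)
  \<comment> \<open>The exponential law enters here: w + 1 = (u + 1)(v + 1).\<close>
  have w: "w = u * v + u + v"
    by (simp add: u_def v_def w_def fps_plus_subst_diff fps_outer_diff fps_plus_subst_exp
        algebra_simps flip: fps_const_sub)
  have nz: "x \<noteq> 0" "y \<noteq> 0" "x + y \<noteq> 0"
  proof -
    show "x \<noteq> 0" "y \<noteq> 0"
      by (simp_all add: x_def y_def)
    have "(x + y) $ 1 $ 0 = 1"
      by (simp add: x_def y_def)
    then show "x + y \<noteq> 0"
      by (metis fps_zero_nth zero_neq_one)
  qed
  then have "u * v * w \<noteq> 0"
    using fu gv hw by auto
  moreover have "(u * v * w) * ((x + y) * f * g) = (u * v * w) * (h * (x * y + y * f + x * g))"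
  proof -
    have "(u * v * w) * ((x + y) * f * g) = (x + y) * (f * u) * (g * v) * w"
      by (simp add: algebra_simps)
    also have "\<dots> = (x + y) * (x * y * u * v + x * y * u + x * y * v)"
      unfolding fu gv w by (simp add: algebra_simps)
    also have "\<dots> = (h * w) * (x * y * u * v + y * (f * u) * v + x * (g * v) * u)"
      unfolding fu gv hw by (simp add: algebra_simps)
    also have "\<dots> = (u * v * w) * (h * (x * y + y * f + x * g))"
      by (simp add: algebra_simps)
    finally show ?thesis .
  qed
  ultimately show ?thesis
    by (metis mult_left_cancel)
qed

section \<open>Generating functions of the double zeta values\<close>

definition zeta2_fps :: "real fps fps" where
  "zeta2_fps = Abs_fps (\<lambda>a. Abs_fps (\<lambda>b. (-1) ^ (a + b) * zeta2_neg a b / (fact a * fact b)))"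

definition zeta2_fps_swap :: "real fps fps" where
  "zeta2_fps_swap = Abs_fps (\<lambda>a. Abs_fps (\<lambda>b. zeta2_fps $ b $ a))"

text \<open>After the factorials are distributed, the closed form is a convolution in y, taken at
  index b + 1 rather than b. This shift is the division by y.\<close>

lemma zeta2_fps_nth:
  "zeta2_fps $ a $ b
    = (\<Sum>k\<le>Suc b. fps_plus_subst bernoulli_tail $ a $ k * bernoulli_fps $ (Suc b - k))"
proof -
  have "zeta2_fps $ a $ b = (\<Sum>k=0..b + 1. 1 / (real (b + 1) * (fact a * fact b)) *
     (real ((b + 1) choose k) * (bernoulli (a + 1 + k) / real (a + 1 + k)) * bernoulli (b + 1 - k)))"
    unfolding sum_distrib_left[symmetric]
    by (simp add: zeta2_fps_def zeta2_neg_def del: sum.cl_ivl_Suc flip: power_add mult_2)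
  also have "\<dots> = (\<Sum>k=0..b + 1. fps_plus_subst bernoulli_tail $ a $ k
      * bernoulli_fps $ (b + 1 - k))"
  proof (rule sum.cong)
    fix k assume "k \<in> {0..b + 1}"
    then have k: "k \<le> b + 1"
      by simp
    have c1: "real ((b + 1) choose k) = real (b + 1) * fact b / (fact k * fact (b + 1 - k))"
      using k by (simp add: binomial_fact)
    have c2: "real ((a + k) choose a) = fact (a + k) / (fact a * fact k)"
      by (simp add: binomial_fact)
    have c3: "(fact (Suc (a + k)) :: real) = real (a + 1 + k) * fact (a + k)"
      by simp
    show "1 / (real (b + 1) * (fact a * fact b)) *
        (real ((b + 1) choose k) * (bernoulli (a + 1 + k) / real (a + 1 + k))
          * bernoulli (b + 1 - k))
      = fps_plus_subst bernoulli_tail $ a $ k * bernoulli_fps $ (b + 1 - k)"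
      unfolding fps_plus_subst_nth c1 c2
      by (simp add: bernoulli_fps_def bernoulli_tail_def c3 del: fact_Suc of_nat_Suc of_nat_add)
  qed simp
  finally show ?thesis
    by (simp add: atMost_atLeast0)
qed

lemma zeta2_fps_mult:
  "fps_const fps_X * zeta2_fps
    = fps_plus_subst bernoulli_tail * fps_const bernoulli_fps - fps_outer bernoulli_tail"
proof (intro fps_ext)
  fix a b
  show "(fps_const fps_X * zeta2_fps) $ a $ b = (fps_plus_subst bernoulli_tail
      * fps_const bernoulli_fps - fps_outer bernoulli_tail) $ a $ b"
  proof (cases b)
    case 0
    \<comment> \<open>At y^0 the product contributes G(x) F(0) = G(x), since B_0 = 1, and the
      subtraction removes it.\<close>
    then show ?thesis
      by (simp add: bernoulli_fps_def bernoulli_0)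
  next
    case (Suc c)
    have "(fps_plus_subst bernoulli_tail $ a * bernoulli_fps) $ Suc c = zeta2_fps $ a $ c"
      by (simp only: fps_mult_nth zeta2_fps_nth atMost_atLeast0)
    then show ?thesis
      by (simp add: Suc)
  qed
qed

lemma zeta2_fps_swap_mult:
  "fps_X * zeta2_fps_swap
    = fps_plus_subst bernoulli_tail * fps_outer bernoulli_fps - fps_const bernoulli_tail"
proof (intro fps_ext)
  fix a b
  show "(fps_X * zeta2_fps_swap) $ a $ b = (fps_plus_subst bernoulli_tail
      * fps_outer bernoulli_fps - fps_const bernoulli_tail) $ a $ b"
  proof (cases a)
    case 0
    then show ?thesis
      by (simp add: bernoulli_fps_def bernoulli_0)
  next
    case (Suc c)
    \<comment> \<open>G(x + y) is symmetric, so the convolution in x becomes the one of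
      \<open>zeta2_fps_nth\<close> with the indices exchanged.\<close>
    have sym: "fps_plus_subst bernoulli_tail $ i $ j = fps_plus_subst bernoulli_tail $ j $ i" for i j
      using binomial_symmetric[of i "i + j"] by (simp add: add.commute)
    have "(fps_plus_subst bernoulli_tail * fps_outer bernoulli_fps) $ Suc c $ b
        = (\<Sum>i=0..Suc c. fps_plus_subst bernoulli_tail $ i $ b * bernoulli_fps $ (Suc c - i))"
      by (simp only: fps_mult_nth[of "fps_plus_subst bernoulli_tail"] fps_sum_nth fps_outer_nth
          fps_mult_right_const_nth)
    also have "\<dots> = zeta2_fps $ b $ c"
      by (simp only: sym[of _ b] zeta2_fps_nth atMost_atLeast0)
    finally show ?thesis
      by (simp add: Suc zeta2_fps_swap_def)
  qed
qed

section \<open>The defect of the product formula\<close>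

definition defect_fps :: "real fps fps" where
  "defect_fps = zeta2_fps + zeta2_fps_swap + fps_plus_subst bernoulli_tail
    - fps_outer bernoulli_tail * fps_const bernoulli_tail"

text \<open>Multiplying by x y as well makes both double zeta series expressible by F and G. Every G
  is then traded for F through F(t) = 1 + t G(t), so that the functional equation applies.\<close>

lemma defect_fps_mult:
  "(fps_X + fps_const fps_X) * defect_fps
    = - (1 + fps_outer bernoulli_tail + fps_const bernoulli_tail)"
proof -
  define x :: "real fps fps" where "x = fps_X"
  define y :: "real fps fps" where "y = fps_const fps_X"
  define A where "A = fps_outer bernoulli_tail"
  define B where "B = fps_const bernoulli_tail"
  define C where "C = fps_plus_subst bernoulli_tail"
  define f where "f = fps_outer bernoulli_fps"
  define g where "g = fps_const bernoulli_fps"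
  define h where "h = fps_plus_subst bernoulli_fps"
  have f: "f = 1 + x * A"
    by (simp add: f_def x_def A_def bernoulli_fps_eq fps_outer_add fps_outer_mult)
  have g: "g = 1 + y * B"
    by (simp add: g_def y_def B_def bernoulli_fps_eq flip: fps_const_add fps_const_mult)
  have h: "h = 1 + (x + y) * C"
    by (simp add: h_def x_def y_def C_def bernoulli_fps_eq fps_plus_subst_add fps_plus_subst_mult
        fps_plus_subst_X)
  have fe: "(x + y) * f * g = h * (x * y + y * f + x * g)"
    unfolding x_def y_def f_def g_def h_def by (rule bernoulli_fps_functional_equation)
  have z1: "y * zeta2_fps = C * g - A"
    unfolding y_def C_def g_def A_def by (rule zeta2_fps_mult)
  have z2: "x * zeta2_fps_swap = C * f - B"
    unfolding x_def C_def f_def B_def by (rule zeta2_fps_swap_mult)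
  have "x * y * ((x + y) * defect_fps)
      = (x + y) * (x * (y * zeta2_fps) + y * (x * zeta2_fps_swap) + x * y * C - x * y * A * B)"
    by (simp add: defect_fps_def A_def B_def C_def algebra_simps)
  also have "\<dots> = ((x + y) * C) * (x * y + y * f + x * g) - (x + y) * (x * A + y * B + x * y * A * B)"
    unfolding z1 z2 by (simp add: algebra_simps)
  also have "(x + y) * C = h - 1"
    by (simp add: h)
  also have "x * A + y * B + x * y * A * B = f * g - 1"
    by (simp add: f g algebra_simps)
  \<comment> \<open>The terms h (x y + y f + x g) and (x + y) f g cancel by the functional
    equation.\<close>
  also have "(h - 1) * (x * y + y * f + x * g) - (x + y) * (f * g - 1)
      = x + y - (x * y + y * f + x * g)"
    using fe by (simp add: algebra_simps)
  also have "\<dots> = x * y * - (1 + A + B)"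
    by (simp add: f g algebra_simps)
  finally have "x * y * ((x + y) * defect_fps) = x * y * - (1 + A + B)" .
  moreover have "x * y \<noteq> 0"
    by (simp add: x_def y_def)
  ultimately have "(x + y) * defect_fps = - (1 + A + B)"
    by (metis mult_left_cancel)
  then show ?thesis
    by (simp only: x_def y_def A_def B_def)
qed

text \<open>The right-hand side of \<open>defect_fps_mult\<close> has no mixed monomials, so a step
  along an antidiagonal only flips the sign. The induction starts from y^0, where only the factor x
  contributes.\<close>

lemma defect_fps_nth: "defect_fps $ a $ b = (-1) ^ Suc b * bernoulli_tail $ Suc (a + b)"
proof (induction b arbitrary: a)
  case 0
  have "((fps_X + fps_const fps_X) * defect_fps) $ Suc a $ 0 = - bernoulli_tail $ Suc a"
    unfolding defect_fps_mult by simp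
  then show ?case
    by (simp add: distrib_right)
next
  case (Suc b)
  have "((fps_X + fps_const fps_X) * defect_fps) $ Suc a $ Suc b = 0"
    unfolding defect_fps_mult by simp
  then have "defect_fps $ a $ Suc b = - defect_fps $ Suc a $ b"
    by (simp add: distrib_right)
  then show ?case
    by (simp add: Suc.IH)
qed

theorem theorem7:
  fixes n1 n2 :: nat
  shows "zeta2_neg n1 n2 + zeta2_neg n2 n1 + zeta1_neg (n1 + n2) - zeta1_neg n1 * zeta1_neg n2
    = (-1) ^ (n1 + 1) * fact n1 * fact n2 / fact (n1 + n2 + 2) * bernoulli (n1 + n2 + 2)"
proof -
  let ?s = "(-1) ^ (n1 + n2) :: real" and ?q = "fact n1 * fact n2 :: real"
  have tail: "bernoulli_tail $ n = (-1) ^ n * zeta1_neg n / fact n" for n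
    by (simp add: bernoulli_tail_def zeta1_neg_def field_simps flip: power_add mult_2)
  \<comment> \<open>The binomial coefficient in G(x + y) turns 1/(n1 + n2)! into 1/(n1! n2!), the
    normalization of the other terms.\<close>
  have "real ((n1 + n2) choose n1) = fact (n1 + n2) / ?q"
    by (simp add: binomial_fact)
  then have "defect_fps $ n1 $ n2 = ?s * (zeta2_neg n1 n2 + zeta2_neg n2 n1
      + zeta1_neg (n1 + n2) - zeta1_neg n1 * zeta1_neg n2) / ?q"
    by (simp add: defect_fps_def zeta2_fps_swap_def zeta2_fps_def tail power_add field_simps)
  then have "zeta2_neg n1 n2 + zeta2_neg n2 n1 + zeta1_neg (n1 + n2) - zeta1_neg n1 * zeta1_neg n2
      = ?s * ?q * defect_fps $ n1 $ n2"
    by (simp flip: power_add mult_2 mult.assoc)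
  also have "\<dots> = ?s * (-1) ^ Suc n2 * ?q * bernoulli_tail $ Suc (n1 + n2)"
    by (simp add: defect_fps_nth)
  \<comment> \<open>The two powers with exponent n2 cancel, leaving a sign in n1 alone.\<close>
  also have "?s * (-1) ^ Suc n2 = (-1) ^ (n1 + 1)"
    by (simp add: power_add flip: power_mult_distrib)
  finally show ?thesis
    by (simp add: bernoulli_tail_def del: fact_Suc)
qed

end
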